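(* Suppose the DAE $\dot y=f(y,z,t)$, $0=g(y,t)$ is Hessenberg index-2 with true solution $[y,z]^T$, and let $[Y,Z]^T$ be its numerical solution. Let $\zeta^y\in\mathbb{R}^n$, $\zeta^z\in\mathbb{R}^m$, let $$P=I-\bar f_z(\bar g_y\bar f_z)^{-1}\bar g_y,$$ and let $(\phi^{(y)},\phi^{(z)})$ solve the adjoint problem with $\psi^y(t)=0$, $\psi^z(t)=0$, i.e. $$-\dot{\phi}^{(y)}=\bar f_y^T\phi^{(y)}+\bar g_y^T\phi^{(z)},\qquad 0=\bar f_z^T\phi^{(y)},\qquad t\in[0,T),$$ with initial condition $$\phi^{(y)}(T)=P^T\left[\zeta^y-\bar f_y^T\bar g_y^T(\bar f_z^T\bar g_y^T)^{-1}\zeta^z-\frac{d\bar g_y^T}{dt}\left(\bar f_z^T\bar g_y^T\right)^{-1}\zeta^z\right]_{t=T}.$$ Then the error $e^{\mathcal{Q}_T}=(e^{(y)}(T),\zeta^y)+(e^{(z)}(T),\zeta^z)$ in the computed quantity of interest $\mathcal{Q}_T(Y,Z)$ is given by $$e^{\mathcal{Q}_T}=\big(\phi^{(y)}(0),e^{(y)}(0)\big)+\langle\phi^{(y)},f(Y,Z)-\dot Y\rangle+\langle\phi^{(z)},g(Y)\rangle-\left(\bar g_y^T(\bar f_z^T\bar g_y^T)^{-1}\zeta^z,\,f(Y,Z)-\dot Y\right)\Bigr|_{t=T}-\left(\left(\bar f_z^T\bar g_y^T\right)^{-1}\zeta^z,\,\frac{d\,g(Y)}{dt}\right)\Bigr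|_{t=T}.$$
   Context: Setting: $y(t)\in\mathbb{R}^n$, $z(t)\in\mathbb{R}^m$, $t\in[0,T]$; $f$ takes values in $\mathbb{R}^n$, $g$ in $\mathbb{R}^m$, both smooth enough that all derivatives that appear exist and are continuous. The DAE is Hessenberg index-2 if $g$ does not depend on $z$ and $g_yf_z\in\mathbb{R}^{m\times m}$ is invertible in a neighborhood of the solution (subscripts denote Jacobians). Explicit dependence on $t$ is suppressed: $f(Y,Z)$ means $f(Y(t),Z(t),t)$, $g(Y)$ means $g(Y(t),t)$, and $\frac{d\,g(Y)}{dt}$ is the total time derivative of $t\mapsto g(Y(t),t)$. Numerical solution: with $t_k=k\Delta t$, $\Delta t=T/N$ (so $t_N=T$), $Y_0=y(0)$, $Z_0=z(0)$, the values satisfy the BDF-1 (implicit Euler) equations $Y_{k+1}=Y_k+\Delta t\,f(Y_{k+1},Z_{k+1},t_{k+1})$, $0=g(Y_{k+1},t_{k+1})$, $k=0,\dots,N-1$. $Y(t),Z(t)$ are the continuous piecewise linear interpolants of these values. Time derivatives are taken piecewise, and at $t=T$ they are left derivatives. $e^{(y)}=y-Y$, $e^{(z)}=z-Z$. $(\cdot,\cdot)$ is the Euclidean inner product and $\langle a,b\rangle=\int_0^T(a(t),b(t))\,dt$. $\mathcal{Q}_T(y,z)=(y(T),\zeta^y)+(z(T),\zeta^z)$ and $e^{\mathcal{Q}_T}=\mathcal{Q}_T(y,z)-\mathcal{Q}_T(Y,Z)$. Linearized operators (functions of $t$): $\bar f_y=\int_0^1\frac{\partial f}{\partial y}(\tilde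 y,\tilde z,t)ds$, $\bar f_z=\int_0^1\frac{\partial f}{\partial z}(\tilde y,\tilde z,t)ds$, $\bar g_y=\int_0^1\frac{\partial g}{\partial y}(\tilde y,t)ds$, with $\tilde y=sy+(1-s)Y$, $\tilde z=sz+(1-s)Z$; since $g$ is independent of $z$, the operator $\bar g_z$ vanishes. Adjoint variables: $\phi^{(y)}(t)\in\mathbb{R}^n$ is continuous on $[0,T]$ (absolutely continuous, equations holding for almost every $t$), $\phi^{(z)}(t)\in\mathbb{R}^m$ is square integrable, initialized consistently with the DAE at $t=T$ (the single value $\phi^{(z)}(T)$ does not enter the claim). The numerical solution is assumed close enough to the true one that $\bar f_z^T\bar g_y^T$ is invertible. *)

theory Defs
  imports "HOL-Analysis.Analysis"
begin

text \<open>
  A DAE \<open>y' = f(y,z,t)\<close>, \<open>0 = g(y,t)\<close> is given by \<open>f\<close> and \<open>g\<close>; that \<open>g\<close> does not depend on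
  \<open>z\<close> is built into its type. The time argument only ever ranges over \<open>{0..T}\<close>.
\<close>

definition jac_fy :: "(real^'n \<Rightarrow> real^'m \<Rightarrow> real \<Rightarrow> real^'n) \<Rightarrow> real^'n \<Rightarrow> real^'m \<Rightarrow> real \<Rightarrow> real^'n^'n" where
  "jac_fy f u v t = jacobian (\<lambda>x. f x v t) (at u)"

definition jac_fz :: "(real^'n \<Rightarrow> real^'m \<Rightarrow> real \<Rightarrow> real^'n) \<Rightarrow> real^'n \<Rightarrow> real^'m \<Rightarrow> real \<Rightarrow> real^'m^'n" where
  "jac_fz f u v t = jacobian (\<lambda>x. f u x t) (at v)"

definition jac_gy :: "(real^'n \<Rightarrow> real \<Rightarrow> real^'m) \<Rightarrow> real^'n \<Rightarrow> real \<Rightarrow> real^'n^'m" where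
  "jac_gy g u t = jacobian (\<lambda>x. g x t) (at u)"

definition C1_on :: "'a::real_normed_vector set \<Rightarrow> ('a \<Rightarrow> 'b::real_normed_vector) \<Rightarrow> bool" where
  "C1_on S F \<longleftrightarrow> (\<exists>F' :: 'a \<Rightarrow> 'a \<Rightarrow>\<^sub>L 'b. continuous_on S F' \<and>
     (\<forall>x\<in>S. (F has_derivative blinfun_apply (F' x)) (at x within S)))"

text \<open>
  The derivatives that occur are the Jacobians of \<open>f\<close> in \<open>y\<close> and in \<open>z\<close>, those of \<open>g\<close> in
  \<open>y\<close> and \<open>t\<close>, and, through the time derivative of the averaged Jacobian of \<open>g\<close>, those of the
  Jacobian \<open>jac_gy g\<close> in \<open>y\<close> and \<open>t\<close>.
\<close>

definition dae_smooth ::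
  "real \<Rightarrow> (real^'n \<Rightarrow> real^'m \<Rightarrow> real \<Rightarrow> real^'n) \<Rightarrow> (real^'n \<Rightarrow> real \<Rightarrow> real^'m) \<Rightarrow> bool" where
  "dae_smooth T f g \<longleftrightarrow>
     continuous_on (UNIV \<times> UNIV \<times> {0..T}) (\<lambda>(u, v, t). f u v t) \<and>
     (\<forall>u v. \<forall>t\<in>{0..T}. (\<lambda>x. f x v t) differentiable (at u) \<and> (\<lambda>x. f u x t) differentiable (at v)) \<and>
     continuous_on (UNIV \<times> UNIV \<times> {0..T}) (\<lambda>(u, v, t). jac_fy f u v t) \<and>
     continuous_on (UNIV \<times> UNIV \<times> {0..T}) (\<lambda>(u, v, t). jac_fz f u v t) \<and>
     C1_on (UNIV \<times> {0..T}) (\<lambda>(u, t). g u t) \<and>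
     C1_on (UNIV \<times> {0..T}) (\<lambda>(u, t). jac_gy g u t)"

definition dae_solution ::
  "real \<Rightarrow> (real^'n \<Rightarrow> real^'m \<Rightarrow> real \<Rightarrow> real^'n) \<Rightarrow> (real^'n \<Rightarrow> real \<Rightarrow> real^'m) \<Rightarrow>
   (real \<Rightarrow> real^'n) \<Rightarrow> (real \<Rightarrow> real^'m) \<Rightarrow> bool" where
  "dae_solution T f g y z \<longleftrightarrow>
     continuous_on {0..T} z \<and>
     (\<forall>t\<in>{0..T}. (y has_vector_derivative f (y t) (z t) t) (at t within {0..T}) \<and> g (y t) t = 0)"

definition hessenberg_index2 ::
  "real \<Rightarrow> (real^'n \<Rightarrow> real^'m \<Rightarrow> real \<Rightarrow> real^'n) \<Rightarrow> (real^'n \<Rightarrow> real \<Rightarrow> real^'m) \<Rightarrow>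
   (real \<Rightarrow> real^'n) \<Rightarrow> (real \<Rightarrow> real^'m) \<Rightarrow> bool" where
  "hessenberg_index2 T f g y z \<longleftrightarrow>
     (\<exists>U. open U \<and> (\<forall>t\<in>{0..T}. (y t, z t, t) \<in> U) \<and>
       (\<forall>u v t. (u, v, t) \<in> U \<and> t \<in> {0..T} \<longrightarrow> invertible (jac_gy g u t ** jac_fz f u v t)))"

text \<open>The BDF-1 (implicit Euler) values on the grid \<open>t\<^sub>k = k T / N\<close>.\<close>

definition bdf1_values ::
  "real \<Rightarrow> nat \<Rightarrow> (real^'n \<Rightarrow> real^'m \<Rightarrow> real \<Rightarrow> real^'n) \<Rightarrow> (real^'n \<Rightarrow> real \<Rightarrow> real^'m) \<Rightarrow>
   real^'n \<Rightarrow> real^'m \<Rightarrow> (nat \<Rightarrow> real^'n) \<Rightarrow> (nat \<Rightarrow> real^'m) \<Rightarrow> bool" where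
  "bdf1_values T N f g y0 z0 Ys Zs \<longleftrightarrow>
     Ys 0 = y0 \<and> Zs 0 = z0 \<and>
     (\<forall>k<N. Ys (Suc k) = Ys k + (T / real N) *\<^sub>R f (Ys (Suc k)) (Zs (Suc k)) (real (Suc k) * (T / real N)) \<and>
            0 = g (Ys (Suc k)) (real (Suc k) * (T / real N)))"

text \<open>
  On \<open>{0..N * h}\<close> only \<open>X 0, \<dots>, X N\<close> matter: at \<open>t = N * h\<close> the entry \<open>X (Suc N)\<close> gets weight 0.
\<close>

definition pl_interpolant :: "real \<Rightarrow> (nat \<Rightarrow> 'a::real_vector) \<Rightarrow> real \<Rightarrow> 'a" where
  "pl_interpolant h X t =
     (let k = nat \<lfloor>t / h\<rfloor> in X k + (t / h - real k) *\<^sub>R (X (Suc k) - X k))"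

text \<open>
  Left time derivative. Strictly inside a piece of a piecewise smooth function it is the ordinary
  derivative; the grid points, where it picks the value from the left, are a null set.
\<close>

definition left_deriv :: "(real \<Rightarrow> 'a::real_normed_vector) \<Rightarrow> real \<Rightarrow> 'a" where
  "left_deriv F t = vector_derivative F (at_left t)"

definition fy_bar ::
  "(real^'n \<Rightarrow> real^'m \<Rightarrow> real \<Rightarrow> real^'n) \<Rightarrow> (real \<Rightarrow> real^'n) \<Rightarrow> (real \<Rightarrow> real^'m) \<Rightarrow>
   (real \<Rightarrow> real^'n) \<Rightarrow> (real \<Rightarrow> real^'m) \<Rightarrow> real \<Rightarrow> real^'n^'n" where
  "fy_bar f y z Y Z t = integral {0..1}
     (\<lambda>s. jac_fy f (s *\<^sub>R y t + (1 - s) *\<^sub>R Y t) (s *\<^sub>R z t + (1 - s) *\<^sub>R Z t) t)"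

definition fz_bar ::
  "(real^'n \<Rightarrow> real^'m \<Rightarrow> real \<Rightarrow> real^'n) \<Rightarrow> (real \<Rightarrow> real^'n) \<Rightarrow> (real \<Rightarrow> real^'m) \<Rightarrow>
   (real \<Rightarrow> real^'n) \<Rightarrow> (real \<Rightarrow> real^'m) \<Rightarrow> real \<Rightarrow> real^'m^'n" where
  "fz_bar f y z Y Z t = integral {0..1}
     (\<lambda>s. jac_fz f (s *\<^sub>R y t + (1 - s) *\<^sub>R Y t) (s *\<^sub>R z t + (1 - s) *\<^sub>R Z t) t)"

definition gy_bar ::
  "(real^'n \<Rightarrow> real \<Rightarrow> real^'m) \<Rightarrow> (real \<Rightarrow> real^'n) \<Rightarrow> (real \<Rightarrow> real^'n) \<Rightarrow> real \<Rightarrow> real^'n^'m" where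
  "gy_bar g y Y t = integral {0..1} (\<lambda>s. jac_gy g (s *\<^sub>R y t + (1 - s) *\<^sub>R Y t) t)"

definition L2_inner :: "real \<Rightarrow> (real \<Rightarrow> 'a::real_inner) \<Rightarrow> (real \<Rightarrow> 'a) \<Rightarrow> real" where
  "L2_inner T a b = (\<integral>t. a t \<bullet> b t \<partial>lebesgue_on {0..T})"

definition square_integrable_on :: "real \<Rightarrow> (real \<Rightarrow> 'a::real_normed_vector) \<Rightarrow> bool" where
  "square_integrable_on T a \<longleftrightarrow>
     a \<in> borel_measurable (lebesgue_on {0..T}) \<and>
     integrable (lebesgue_on {0..T}) (\<lambda>t. (norm (a t))\<^sup>2)"

definition abs_continuous_on :: "real set \<Rightarrow> (real \<Rightarrow> 'a::real_normed_vector) \<Rightarrow> bool" where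
  "abs_continuous_on S F \<longleftrightarrow>
     (\<forall>\<epsilon>>0. \<exists>\<delta>>0. \<forall>D. D division_of \<Union>D \<and> \<Union>D \<subseteq> S \<and> (\<Sum>K\<in>D. measure lborel K) < \<delta> \<longrightarrow>
        (\<Sum>K\<in>D. norm (F (Sup K) - F (Inf K))) < \<epsilon>)"

text \<open>
  The homogeneous adjoint DAE, with \<open>A\<close>, \<open>B\<close>, \<open>C\<close> in the roles of the averaged Jacobians
  \<open>fy_bar\<close>, \<open>fz_bar\<close>, \<open>gy_bar\<close>. The value at \<open>T\<close> is prescribed separately.
\<close>

definition adjoint_solution ::
  "real \<Rightarrow> (real \<Rightarrow> real^'n^'n) \<Rightarrow> (real \<Rightarrow> real^'m^'n) \<Rightarrow> (real \<Rightarrow> real^'n^'m) \<Rightarrow>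
   (real \<Rightarrow> real^'n) \<Rightarrow> (real \<Rightarrow> real^'m) \<Rightarrow> bool" where
  "adjoint_solution T A B C \<phi>y \<phi>z \<longleftrightarrow>
     abs_continuous_on {0..T} \<phi>y \<and> square_integrable_on T \<phi>z \<and>
     (AE t in lebesgue_on {0..T}.
        (\<phi>y has_vector_derivative - (transpose (A t) *v \<phi>y t + transpose (C t) *v \<phi>z t)) (at t) \<and>
        0 = transpose (B t) *v \<phi>y t)"

definition qoi :: "real \<Rightarrow> real^'n \<Rightarrow> real^'m \<Rightarrow> (real \<Rightarrow> real^'n) \<Rightarrow> (real \<Rightarrow> real^'m) \<Rightarrow> real" where
  "qoi T \<zeta>y \<zeta>z y z = y T \<bullet> \<zeta>y + z T \<bullet> \<zeta>z"

end

theory Submission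
  imports Defs
begin

text \<open>
  Let \<open>e = y - Y\<close>, \<open>d = z - Z\<close> and let \<open>r = f(Y,Z) - Y'\<close> be the residual of the differential
  equation. The mean value theorem in integral form turns the two nonlinear equations into exact
  linear ones with the averaged Jacobians as coefficients:
  \<open>e' = fy e + fz d + r\<close> away from the grid points and \<open>gy e = - g(Y)\<close> everywhere
  (\<open>mean_value_averaged_jacobians\<close>, \<open>dae_smooth_f_error\<close>, \<open>dae_smooth_g_error\<close>).

  The adjoint problem is the formal transpose of this linear DAE. Therefore
  \<open>(\<phi>y \<bullet> e)' = \<phi>y \<bullet> r + \<phi>z \<bullet> g(Y)\<close> almost everywhere, and integration gives
  \<open>\<phi>y(T) \<bullet> e(T) = \<phi>y(0) \<bullet> e(0) + \<langle>\<phi>y, r\<rangle> + \<langle>\<phi>z, g(Y)\<rangle>\<close> (\<open>adjoint_duality\<close>). Since the adjoint is only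
  absolutely continuous, this uses the fundamental theorem of calculus for absolutely continuous
  functions (\<open>abs_continuous_on_has_integral_derivative\<close>).

  It remains to compare \<open>\<phi>y(T) \<bullet> e(T)\<close> with the error in the quantity of interest
  (\<open>terminal_adjoint_pairing\<close>). Because \<open>T\<close> is a grid point, the numerical solution satisfies the
  constraint there, so \<open>gy e = 0\<close> at \<open>T\<close> and the projection \<open>P\<close> leaves \<open>e(T)\<close> unchanged. The
  algebraic error \<open>d(T)\<close> enters only through \<open>e'\<close>, and is recovered from the left derivative of
  \<open>gy e = - g(Y)\<close> at \<open>T\<close>, namely \<open>gy' e + gy (fy e + fz d + r) = - g(Y)'\<close>, by inverting \<open>gy fz\<close>. The
  terms with \<open>\<zeta>z\<close> in \<open>\<phi>y(T)\<close> are chosen to produce the contribution of \<open>gy' e + gy fy e\<close>, and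
  \<open>gy r\<close> and \<open>g(Y)'\<close> are left as the two boundary terms at \<open>T\<close>. That \<open>gy\<close> is differentiable from
  the left follows by differentiating under the integral that defines it
  (\<open>C1_on_segment_average_has_vector_derivative\<close>), since \<open>Y\<close> is affine on the last grid cell.
\<close>

section \<open>Absolutely continuous and Lipschitz functions\<close>

lemma abs_continuous_onD:
  assumes "abs_continuous_on S F" "\<epsilon> > 0"
  obtains \<delta> where "\<delta> > 0"
    "\<And>D. D division_of \<Union>D \<Longrightarrow> \<Union>D \<subseteq> S \<Longrightarrow> (\<Sum>K\<in>D. measure lborel K) < \<delta> \<Longrightarrow>
        (\<Sum>K\<in>D. norm (F (Sup K) - F (Inf K))) < \<epsilon>"
proof -
  from assms obtain \<delta> where "\<delta> > 0" and *: "\<forall>D. D division_of \<Union>D \<and> \<Union>D \<subseteq> S \<and>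
      (\<Sum>K\<in>D. measure lborel K) < \<delta> \<longrightarrow> (\<Sum>K\<in>D. norm (F (Sup K) - F (Inf K))) < \<epsilon>"
    unfolding abs_continuous_on_def by meson
  show thesis by (rule that[OF \<open>\<delta> > 0\<close>]) (simp add: *)
qed

lemma abs_continuous_on_imp_continuous_on:
  fixes F :: "real \<Rightarrow> 'a::real_normed_vector"
  assumes "abs_continuous_on {a..b} F"
  shows "continuous_on {a..b} F"
proof (clarsimp simp: continuous_on_iff)
  fix x e :: real
  assume x: "a \<le> x" "x \<le> b" and "0 < e"
  from abs_continuous_onD[OF assms this(3)] obtain \<delta> where \<delta>: "\<delta> > 0"
    "\<And>D. D division_of \<Union>D \<Longrightarrow> \<Union>D \<subseteq> {a..b} \<Longrightarrow> (\<Sum>K\<in>D. measure lborel K) < \<delta> \<Longrightarrow>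
        (\<Sum>K\<in>D. norm (F (Sup K) - F (Inf K))) < e" by blast
  have *: "norm (F t - F s) < e" if "s \<le> t" "t - s < \<delta>" "a \<le> s" "t \<le> b" for s t
  proof -
    have "{cbox s t} division_of cbox s t" using that by (intro division_of_self) simp
    then have "(\<Sum>K\<in>{cbox s t}. norm (F (Sup K) - F (Inf K))) < e"
      using that by (intro \<delta>(2)) auto
    then show ?thesis using that by simp
  qed
  have "dist (F x') (F x) < e" if "x' \<in> {a..b}" "dist x' x < \<delta>" for x'
  proof (cases "x \<le> x'")
    case True
    then show ?thesis using *[of x x'] x that by (simp add: dist_norm)
  next
    case False
    then have "norm (F x - F x') < e" using x that by (intro *) (auto simp: dist_norm)
    then show ?thesis by (simp add: dist_norm norm_minus_commute)
  qed
  then show "\<exists>d>0. \<forall>x'\<in>{a..b}. dist x' x < d \<longrightarrow> dist (F x') (F x) < e"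
    using \<delta>(1) by blast
qed

text \<open>
  The pairing of the adjoint with the error is of this kind: the adjoint is only absolutely
  continuous, whereas the error is Lipschitz.
\<close>

lemma abs_continuous_on_inner_lipschitz:
  fixes u v :: "real \<Rightarrow> 'a::euclidean_space"
  assumes u: "abs_continuous_on {a..b} u" and v: "L-lipschitz_on {a..b} v"
  shows "abs_continuous_on {a..b} (\<lambda>t. u t \<bullet> v t)"
  unfolding abs_continuous_on_def
proof (intro allI impI)
  fix e :: real
  assume e: "e > 0"
  have "bounded (u ` {a..b})" "bounded (v ` {a..b})"
    using abs_continuous_on_imp_continuous_on[OF u] lipschitz_on_continuous_on[OF v]
    by (auto intro!: compact_imp_bounded compact_continuous_image)
  then obtain Bu Bv where B: "Bu > 0" "Bv > 0"
      "\<And>t. t \<in> {a..b} \<Longrightarrow> norm (u t) \<le> Bu" "\<And>t. t \<in> {a..b} \<Longrightarrow> norm (v t) \<le> Bv"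
    unfolding bounded_pos by blast
  have L: "L \<ge> 0" using v by (rule lipschitz_on_nonneg)
  have "e / (2 * Bv) > 0" using e B(2) by simp
  from abs_continuous_onD[OF u this] obtain d where d: "d > 0"
    "\<And>D. D division_of \<Union>D \<Longrightarrow> \<Union>D \<subseteq> {a..b} \<Longrightarrow> (\<Sum>K\<in>D. measure lborel K) < d \<Longrightarrow>
        (\<Sum>K\<in>D. norm (u (Sup K) - u (Inf K))) < e / (2 * Bv)" by blast
  show "\<exists>\<delta>>0. \<forall>D. D division_of \<Union>D \<and> \<Union>D \<subseteq> {a..b} \<and> (\<Sum>K\<in>D. measure lborel K) < \<delta> \<longrightarrow>
        (\<Sum>K\<in>D. norm (u (Sup K) \<bullet> v (Sup K) - u (Inf K) \<bullet> v (Inf K))) < e"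
  proof (intro exI conjI allI impI)
    show "min d (e / (2 * Bu * (L + 1))) > 0"
      using d(1) e B(1) L by simp
    fix D assume "D division_of \<Union>D \<and> \<Union>D \<subseteq> {a..b} \<and>
      (\<Sum>K\<in>D. measure lborel K) < min d (e / (2 * Bu * (L + 1)))"
    then have D: "D division_of \<Union>D" "\<Union>D \<subseteq> {a..b}" and less: "(\<Sum>K\<in>D. measure lborel K) < d"
      "(\<Sum>K\<in>D. measure lborel K) < e / (2 * Bu * (L + 1))" by auto
    have "(\<Sum>K\<in>D. norm (u (Sup K) \<bullet> v (Sup K) - u (Inf K) \<bullet> v (Inf K))) \<le>
      (\<Sum>K\<in>D. Bv * norm (u (Sup K) - u (Inf K)) + Bu * (L + 1) * measure lborel K)"
    proof (rule sum_mono)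
      fix K assume K: "K \<in> D"
      then obtain c d where cd: "K = {c..d}" "K \<noteq> {}"
        using D(1) by (metis box_real(2) division_ofD(3) division_ofD(4))
      have "K \<subseteq> {a..b}" using K D by blast
      then have mem: "c \<in> {a..b}" "d \<in> {a..b}" "c \<le> d" using cd by auto
      have "u d \<bullet> v d - u c \<bullet> v c = (u d - u c) \<bullet> v d + u c \<bullet> (v d - v c)"
        by (simp add: inner_diff)
      also have "norm \<dots> \<le> norm (u d - u c) * norm (v d) + norm (u c) * norm (v d - v c)"
        using Cauchy_Schwarz_ineq2[of "u d - u c" "v d"] Cauchy_Schwarz_ineq2[of "u c" "v d - v c"]
        by (simp only: real_norm_def)
      also have "\<dots> \<le> norm (u d - u c) * Bv + Bu * ((L + 1) * (d - c))"
      proof (intro add_mono mult_mono mult_left_mono)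
        have "norm (v d - v c) \<le> L * (d - c)"
          using lipschitz_onD[OF v mem(2,1)] mem by (simp add: dist_norm)
        also have "\<dots> \<le> (L + 1) * (d - c)" using mem by (intro mult_right_mono) auto
        finally show "norm (v d - v c) \<le> (L + 1) * (d - c)" .
      qed (use B(1,2) B(3)[OF mem(1)] B(4)[OF mem(2)] mem(3) L in simp_all)
      finally show "norm (u (Sup K) \<bullet> v (Sup K) - u (Inf K) \<bullet> v (Inf K)) \<le>
          Bv * norm (u (Sup K) - u (Inf K)) + Bu * (L + 1) * measure lborel K"
        using cd mem by (simp add: mult_ac)
    qed
    also have "\<dots> = Bv * (\<Sum>K\<in>D. norm (u (Sup K) - u (Inf K))) + Bu * (L + 1) * (\<Sum>K\<in>D. measure lborel K)"
      by (simp only: sum.distrib sum_distrib_left)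
    also have "\<dots> < Bv * (e / (2 * Bv)) + Bu * (L + 1) * (e / (2 * Bu * (L + 1)))"
    proof (rule add_strict_mono)
      show "Bv * (\<Sum>K\<in>D. norm (u (Sup K) - u (Inf K))) < Bv * (e / (2 * Bv))"
        by (rule mult_strict_left_mono[OF d(2)[OF D less(1)] B(2)])
      show "Bu * (L + 1) * (\<Sum>K\<in>D. measure lborel K) < Bu * (L + 1) * (e / (2 * Bu * (L + 1)))"
        by (rule mult_strict_left_mono[OF less(2)]) (use B(1) L in simp)
    qed
    also have "\<dots> = e"
    proof -
      have half: "c * (e / (2 * c)) = e / 2" if "c > 0" for c :: real using that by simp
      show ?thesis
        using half[OF B(2)] half[of "Bu * (L + 1)"] B(1) L by (simp only: mult.assoc) simp
    qed
    finally show "(\<Sum>K\<in>D. norm (u (Sup K) \<bullet> v (Sup K) - u (Inf K) \<bullet> v (Inf K))) < e" .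
  qed
qed

text \<open>
  Distinct cells of a division overlap in null sets only, so their lengths add up to the measure of
  their union.
\<close>

lemma sum_content_division_le_measure:
  assumes D: "D division_of \<Union>D" and U: "\<Union>D \<subseteq> U" "U \<in> lmeasurable"
  shows "(\<Sum>K\<in>D. measure lborel K) \<le> measure lebesgue U"
proof -
  have box: "\<exists>a b. K = cbox a b" if "K \<in> D" for K
    using D that by (rule division_ofD(4))
  have "(\<Sum>K\<in>D. measure lborel K) = (\<Sum>K\<in>D. measure lebesgue K)"
    by (intro sum.cong refl) (auto dest: box simp: measure_completion)
  also have "\<dots> = measure lebesgue (\<Union>D)"
  proof (rule measure_negligible_finite_Union[symmetric])
    show "finite D" using D by blast
    show "K \<in> lmeasurable" if "K \<in> D" for K using box[OF that] by auto
    show "pairwise (\<lambda>S T. negligible (S \<inter> T)) D"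
    proof (rule pairwiseI)
      fix K L assume KL: "K \<in> D" "L \<in> D" "K \<noteq> L"
      then have "interior (K \<inter> L) = {}" using division_ofD(5)[OF D] by auto
      moreover obtain a b where "K = cbox a b" using box KL(1) by blast
      moreover obtain c d where "L = cbox c d" using box KL(2) by blast
      ultimately show "negligible (K \<inter> L)"
        by (simp add: negligible_convex_interior convex_Int)
    qed
  qed
  also have "\<dots> \<le> measure lebesgue U"
    using U D by (intro measure_mono_fmeasurable) (auto intro!: sets.finite_Union dest: box)
  finally show ?thesis .
qed

text \<open>
  The fundamental theorem of calculus for an almost everywhere derivative, by a Henstock gauge. At
  tags outside the exceptional null set \<open>S\<close> the gauge is the one of the straddle lemma. At tags
  inside \<open>S\<close> it is an open set \<open>U\<close> that contains \<open>S\<close> and has small measure: all cells with such tags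
  lie in \<open>U\<close>, their total length is small, and absolute continuity bounds the sum of the
  increments of \<open>F\<close> over them.
\<close>

theorem abs_continuous_on_has_integral_derivative:
  fixes F F' :: "real \<Rightarrow> 'a::banach"
  assumes ab: "a \<le> b" and F: "abs_continuous_on {a..b} F" and S: "negligible S"
    and deriv: "\<And>t. t \<in> {a..b} - S \<Longrightarrow> (F has_vector_derivative F' t) (at t within {a..b})"
  shows "(F' has_integral F b - F a) {a..b}"
proof (rule has_integral_spike[OF S])
  \<comment> \<open>Zero values on \<open>S\<close> remove the Riemann sum over the bad tags.\<close>
  let ?G = "\<lambda>t. if t \<in> S then 0 else F' t"
  show "F' t = ?G t" if "t \<in> {a..b} - S" for t using that by simp
  show "(?G has_integral F b - F a) {a..b}"
    unfolding has_integral_real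
  proof (intro allI impI)
    fix e :: real assume e: "e > 0"
    define \<eta> where "\<eta> = e / (2 * (b - a + 1))"
    have \<eta>: "\<eta> > 0" using e ab by (simp add: \<eta>_def)
    have "e / 2 > 0" using e by simp
    from abs_continuous_onD[OF F this] obtain \<delta> where \<delta>: "\<delta> > 0"
      "\<And>D. D division_of \<Union>D \<Longrightarrow> \<Union>D \<subseteq> {a..b} \<Longrightarrow> (\<Sum>K\<in>D. measure lborel K) < \<delta> \<Longrightarrow>
        (\<Sum>K\<in>D. norm (F (Sup K) - F (Inf K))) < e / 2" by blast
    obtain U where U: "open U" "S \<subseteq> U" "U \<in> lmeasurable" "measure lebesgue U < \<delta>"
    proof -
      have Sm: "S \<in> lmeasurable" "measure lebesgue S = 0"
        using S by (auto simp: negligible_iff_measure)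
      then obtain U where U: "open U" "S \<subseteq> U" "U - S \<in> lmeasurable" "emeasure lebesgue (U - S) < ennreal \<delta>"
        using sets_lebesgue_outer_open[OF fmeasurableD[OF Sm(1)] \<delta>(1)] by metis
      have eq: "(U - S) \<union> S = U" using U(2) by blast
      have "U \<in> lmeasurable" using fmeasurable.Un[OF U(3) Sm(1)] unfolding eq .
      moreover have "measure lebesgue U = measure lebesgue (U - S)"
        using Sm \<open>U \<in> lmeasurable\<close> S
        by (simp add: measure_Diff_null_set negligible_iff_null_sets fmeasurableD)
      moreover have "measure lebesgue (U - S) < \<delta>"
        using U(3,4) \<delta>(1) by (simp add: emeasure_eq_measure2 ennreal_less_iff)
      ultimately show ?thesis using that U by simp
    qed
    have "\<forall>x. \<exists>d>0. x \<in> {a..b} - S \<longrightarrow>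
         (\<forall>y\<in>{a..b}. norm (y-x) < d \<longrightarrow> norm (F y - F x - (y-x) *\<^sub>R F' x) \<le> \<eta> * norm (y-x))"
    proof
      fix x
      show "\<exists>d>0. x \<in> {a..b} - S \<longrightarrow>
         (\<forall>y\<in>{a..b}. norm (y-x) < d \<longrightarrow> norm (F y - F x - (y-x) *\<^sub>R F' x) \<le> \<eta> * norm (y-x))"
      proof (cases "x \<in> {a..b} - S")
        case True
        then show ?thesis
          using deriv[OF True, unfolded has_vector_derivative_def has_derivative_within_alt] \<eta> by blast
      qed (auto intro: exI[of _ 1])
    qed
    then obtain d where d: "\<And>x. 0 < d x"
       "\<And>x y. \<lbrakk>x \<in> {a..b} - S; y \<in> {a..b}; norm (y-x) < d x\<rbrakk>
           \<Longrightarrow> norm (F y - F x - (y-x) *\<^sub>R F' x) \<le> \<eta> * norm (y-x)"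
      by metis
    define \<gamma> where "\<gamma> x = (if x \<in> S then U else ball x (d x))" for x
    show "\<exists>\<gamma>. gauge \<gamma> \<and> (\<forall>p. p tagged_division_of {a..b} \<and> \<gamma> fine p \<longrightarrow>
        norm ((\<Sum>(x, K)\<in>p. measure lborel K *\<^sub>R ?G x) - (F b - F a)) < e)"
    proof (intro exI[of _ \<gamma>] conjI allI impI)
      show "gauge \<gamma>" using U d(1) by (auto simp: gauge_def \<gamma>_def)
      fix p assume "p tagged_division_of {a..b} \<and> \<gamma> fine p"
      then have p: "p tagged_division_of {a..b}" and fine: "\<gamma> fine p" by auto
      have fin: "finite p" by (rule tagged_division_ofD(1)[OF p])
      define q where "q = {(x, K) \<in> p. x \<in> S}"
      define r where "r = p - q"
      have q: "q \<subseteq> p" by (auto simp: q_def)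
      have F_eq: "F b - F a = (\<Sum>(x,K)\<in>p. F (Sup K) - F (Inf K))"
        and ba: "b - a = (\<Sum>(x,K)\<in>p. Sup K - Inf K)"
        using additive_tagged_division_1[OF ab p, of F]
          additive_tagged_division_1[OF ab p, of "\<lambda>x. x"] by auto
      have piece: "\<exists>c d. K = {c..d} \<and> c \<le> x \<and> x \<le> d \<and> a \<le> c \<and> d \<le> b" if xK: "(x, K) \<in> p" for x K
      proof -
        obtain c d where "K = cbox c d" using tagged_division_ofD(4)[OF p xK] by blast
        moreover have "x \<in> K" "K \<subseteq> {a..b}" using tagged_division_ofD(2,3)[OF p xK] by auto
        ultimately show ?thesis by auto
      qed
      have good: "norm (measure lborel K *\<^sub>R ?G x - (F (Sup K) - F (Inf K))) \<le> \<eta> * (Sup K - Inf K)"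
        if xK: "(x, K) \<in> r" for x K
      proof -
        obtain u v where K: "K = {u..v}" "u \<le> x" "x \<le> v" "a \<le> u" "v \<le> b"
          using piece[of x K] xK by (auto simp: r_def)
        have x: "x \<in> {a..b} - S" using xK K by (auto simp: r_def q_def)
        have "K \<subseteq> ball x (d x)" using fineD[OF fine, of x K] xK x by (simp add: r_def \<gamma>_def)
        moreover have "u \<in> K" "v \<in> K" using K by auto
        ultimately have "u \<in> ball x (d x)" "v \<in> ball x (d x)" by auto
        then have "norm (F u - F x - (u - x) *\<^sub>R F' x) \<le> \<eta> * norm (u - x)"
          "norm (F v - F x - (v - x) *\<^sub>R F' x) \<le> \<eta> * norm (v - x)"
          using d(2)[OF x, of u] d(2)[OF x, of v] K by (auto simp: dist_real_def)
        moreover have "(v - u) *\<^sub>R F' x - (F v - F u) =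
            (F u - F x - (u - x) *\<^sub>R F' x) - (F v - F x - (v - x) *\<^sub>R F' x)"
          by (auto simp: algebra_simps)
        ultimately have "norm ((v - u) *\<^sub>R F' x - (F v - F u)) \<le> \<eta> * norm (u - x) + \<eta> * norm (v - x)"
          by (smt (verit) norm_triangle_ineq4)
        also have "\<dots> = \<eta> * (v - u)" using K by (simp add: algebra_simps)
        finally show ?thesis using K x by simp
      qed
      have bad: "(\<Sum>(x,K)\<in>q. norm (F (Sup K) - F (Inf K))) < e / 2"
      proof -
        have qp: "q tagged_partial_division_of {a..b}"
          using tagged_partial_division_subset[OF _ q] p by (simp add: tagged_division_of_def)
        have div: "snd ` q division_of \<Union>(snd ` q)"
          using tagged_partial_division_of_Union_self[OF qp] by (rule division_of_tagged_division)
        have "K \<subseteq> U" if "(x, K) \<in> q" for x K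
          using fineD[OF fine, of x K] that by (auto simp: q_def \<gamma>_def)
        then have "\<Union>(snd ` q) \<subseteq> U" by fastforce
        then have "(\<Sum>K\<in>snd ` q. measure lborel K) < \<delta>"
          using sum_content_division_le_measure[OF div _ U(3)] U(4) by linarith
        moreover have "\<Union>(snd ` q) \<subseteq> {a..b}"
          using tagged_partial_division_ofD(3)[OF qp] by (auto simp: subset_iff)
        ultimately have "(\<Sum>K\<in>snd ` q. norm (F (Sup K) - F (Inf K))) < e / 2"
          by (intro \<delta>(2)[OF div])
        moreover have "(\<Sum>(x,K)\<in>q. norm (F (Sup K) - F (Inf K))) =
            (\<Sum>K\<in>snd ` q. norm (F (Sup K) - F (Inf K)))"
        proof -
          \<comment> \<open>\<open>Sup\<close> and \<open>Inf\<close> of the empty set are unspecified reals, while reindexing over cells asks for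
            the value 0 at every degenerate cell, the empty one included.\<close>
          let ?g = "\<lambda>K. if K = {} then 0 else norm (F (Sup K) - F (Inf K))"
          have ne: "K \<noteq> {}" if "(x, K) \<in> q" for x K
            using tagged_partial_division_ofD(2)[OF qp that] by blast
          have "(\<Sum>(x,K)\<in>q. norm (F (Sup K) - F (Inf K))) = (\<Sum>(x,K)\<in>q. ?g K)"
            using ne by (intro sum.cong refl) auto
          also have "\<dots> = (\<Sum>K\<in>snd ` q. ?g K)"
          proof (rule sum.over_tagged_division_lemma[OF tagged_partial_division_of_Union_self[OF qp]])
            fix u v :: real assume "box u v = {}"
            then have "v \<le> u" by simp
            then show "?g (cbox u v) = 0" by (cases "u = v") auto
          qed
          also have "\<dots> = (\<Sum>K\<in>snd ` q. norm (F (Sup K) - F (Inf K)))"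
            using ne by (intro sum.cong refl) auto
          finally show ?thesis .
        qed
        ultimately show ?thesis by simp
      qed
      have "(\<Sum>(x, K)\<in>p. measure lborel K *\<^sub>R ?G x) - (F b - F a) =
          (\<Sum>(x, K)\<in>p. measure lborel K *\<^sub>R ?G x - (F (Sup K) - F (Inf K)))"
        unfolding F_eq by (simp add: sum_subtractf split_def)
      also have "\<dots> = (\<Sum>(x, K)\<in>r. measure lborel K *\<^sub>R ?G x - (F (Sup K) - F (Inf K))) +
          (\<Sum>(x, K)\<in>q. measure lborel K *\<^sub>R ?G x - (F (Sup K) - F (Inf K)))"
        unfolding r_def by (rule sum.subset_diff[OF q fin])
      also have "norm \<dots> \<le> (\<Sum>(x, K)\<in>r. \<eta> * (Sup K - Inf K)) +
          (\<Sum>(x, K)\<in>q. norm (F (Sup K) - F (Inf K)))"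
      proof (intro order_trans[OF norm_triangle_ineq] add_mono sum_norm_le)
        fix xK assume "xK \<in> q"
        then show "norm (case xK of (x, K) \<Rightarrow> measure lborel K *\<^sub>R ?G x - (F (Sup K) - F (Inf K))) \<le>
            (case xK of (x, K) \<Rightarrow> norm (F (Sup K) - F (Inf K)))"
          by (auto simp: q_def norm_minus_commute)
      qed (use good in auto)
      also have "(\<Sum>(x, K)\<in>r. \<eta> * (Sup K - Inf K)) \<le> (\<Sum>(x, K)\<in>p. \<eta> * (Sup K - Inf K))"
      proof (rule sum_mono2[OF fin])
        fix xK assume "xK \<in> p - r"
        then show "0 \<le> (case xK of (x, K) \<Rightarrow> \<eta> * (Sup K - Inf K))"
          using piece[of "fst xK" "snd xK"] \<eta> by (auto simp: split_def)
      qed (auto simp: r_def)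
      also have "\<dots> = \<eta> * (b - a)" unfolding ba by (simp add: sum_distrib_left split_def)
      also have "\<dots> \<le> e / 2" using e ab by (simp add: \<eta>_def field_simps)
      finally show "norm ((\<Sum>(x, K)\<in>p. measure lborel K *\<^sub>R ?G x) - (F b - F a)) < e"
        using bad by linarith
    qed
  qed
qed

lemma lipschitz_on_continuous_vector_derivative:
  fixes y :: "real \<Rightarrow> 'a::real_normed_vector"
  assumes "\<And>t. t \<in> {a..b} \<Longrightarrow> (y has_vector_derivative y' t) (at t within {a..b})"
    and "continuous_on {a..b} y'"
  obtains L where "L-lipschitz_on {a..b} y"
proof -
  have "bounded (y' ` {a..b})"
    using assms(2) by (intro compact_imp_bounded compact_continuous_image) auto
  then obtain L where L: "L > 0" "\<And>t. t \<in> {a..b} \<Longrightarrow> norm (y' t) \<le> L"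
    unfolding bounded_pos by blast
  have "L-lipschitz_on {a..b} y"
  proof (rule bounded_derivative_imp_lipschitz)
    fix t assume t: "t \<in> {a..b}"
    show "(y has_derivative (\<lambda>h. h *\<^sub>R y' t)) (at t within {a..b})"
      using assms(1)[OF t] by (simp add: has_vector_derivative_def)
    show "onorm (\<lambda>h. h *\<^sub>R y' t) \<le> L"
      using L(2)[OF t] by (intro onorm_le) (simp add: mult.commute[of L] mult_left_mono)
  qed (use L in auto)
  then show thesis by (rule that)
qed

section \<open>Piecewise linear interpolants\<close>

lemma left_deriv_eqI:
  assumes "(F has_vector_derivative D) (at t within {c..t})" "c < t"
  shows "left_deriv F t = D"
  unfolding left_deriv_def using assms
  by (metis at_within_Icc_at_left trivial_limit_at_left_real vector_derivative_within)

text \<open>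
  The right end point of the cell belongs to the next value of \<open>nat \<lfloor>t / h\<rfloor>\<close>; there the formula holds
  because both pieces take the value \<open>X (Suc k)\<close>.
\<close>

lemma pl_interpolant_piece:
  assumes h: "h > 0" and t: "t \<in> {real k * h..real (Suc k) * h}"
  shows "pl_interpolant h X t = X k + (t / h - real k) *\<^sub>R (X (Suc k) - X k)"
proof (cases "t = real (Suc k) * h")
  case True
  then have "t / h = real (Suc k)" using h by simp
  then show ?thesis unfolding pl_interpolant_def Let_def by (simp del: of_nat_Suc) simp
next
  case False
  then have "real k \<le> t / h" "t / h < real k + 1" using t h by (auto simp: field_simps)
  then have "nat \<lfloor>t / h\<rfloor> = k" by linarith
  then show ?thesis by (simp add: pl_interpolant_def Let_def)
qed

lemma pl_interpolant_grid:
  assumes "h > 0"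
  shows "pl_interpolant h X (real k * h) = X k"
  using pl_interpolant_piece[OF assms, of "real k * h" k X] assms by simp

lemma pl_interpolant_has_vector_derivative:
  fixes X :: "nat \<Rightarrow> 'a::real_normed_vector"
  assumes h: "h > 0" and t: "t \<in> {real k * h..real (Suc k) * h}"
  shows "(pl_interpolant h X has_vector_derivative (1 / h) *\<^sub>R (X (Suc k) - X k))
    (at t within {real k * h..real (Suc k) * h})"
proof (rule has_vector_derivative_transform[OF t])
  show "((\<lambda>t. X k + (t / h - real k) *\<^sub>R (X (Suc k) - X k)) has_vector_derivative
     (1 / h) *\<^sub>R (X (Suc k) - X k)) (at t within {real k * h..real (Suc k) * h})"
    using h by (auto intro!: derivative_eq_intros simp: field_simps)
qed (simp add: pl_interpolant_piece[OF h])

text \<open>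
  Cells are half open on the left, because a left derivative at a grid point sees the cell that ends
  there.
\<close>

lemma grid_cell:
  assumes "h > 0" "t > 0"
  defines "k \<equiv> nat \<lceil>t / h\<rceil> - 1"
  shows "real k * h < t" "t \<le> real (Suc k) * h"
proof -
  have "t / h > 0" using assms by simp
  then have "\<lceil>t / h\<rceil> \<ge> 1" by simp
  moreover have "int k = int (nat \<lceil>t / h\<rceil> - 1)" by (simp add: k_def)
  ultimately have "int k = \<lceil>t / h\<rceil> - 1" by linarith
  then have "real k = of_int \<lceil>t / h\<rceil> - 1" by linarith
  with \<open>t / h > 0\<close> have "real k < t / h" "t / h \<le> real (Suc k)" by linarith+
  then show "real k * h < t" "t \<le> real (Suc k) * h" using assms(1)
    by (simp_all only: pos_less_divide_eq pos_divide_le_eq)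
qed

lemma left_deriv_pl_interpolant:
  fixes X :: "nat \<Rightarrow> 'a::real_normed_vector"
  assumes h: "h > 0" and t: "real k * h < t" "t \<le> real (Suc k) * h"
  shows "left_deriv (pl_interpolant h X) t = (1 / h) *\<^sub>R (X (Suc k) - X k)"
proof (rule left_deriv_eqI)
  show "(pl_interpolant h X has_vector_derivative (1 / h) *\<^sub>R (X (Suc k) - X k)) (at t within {real k * h..t})"
    using t by (intro has_vector_derivative_within_subset[OF pl_interpolant_has_vector_derivative[OF h]]) auto
qed (fact t)

lemma pl_interpolant_lipschitz:
  fixes X :: "nat \<Rightarrow> 'a::real_normed_vector"
  assumes h: "h > 0" and N: "N > 0"
  obtains L where "L-lipschitz_on {0..real N * h} (pl_interpolant h X)"
proof -
  define L where "L = (\<Sum>k<N. norm ((1 / h) *\<^sub>R (X (Suc k) - X k)))"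
  have "L-lipschitz_on {0..real N * h} (pl_interpolant h X)"
  proof (rule lipschitz_on_closed_Union[where I = "{..<N}" and U = "\<lambda>k. {real k * h..real (Suc k) * h}"])
    show "{0..real N * h} \<subseteq> (\<Union>k\<in>{..<N}. {real k * h..real (Suc k) * h})"
    proof
      fix t assume t: "t \<in> {0..real N * h}"
      show "t \<in> (\<Union>k\<in>{..<N}. {real k * h..real (Suc k) * h})"
      proof (cases "t = 0")
        case True then show ?thesis using N h by (auto intro!: bexI[of _ 0])
      next
        case False
        let ?k = "nat \<lceil>t / h\<rceil> - 1"
        have c: "real ?k * h < t" "t \<le> real (Suc ?k) * h"
          using grid_cell[OF h, of t] t False by auto
        then have "real ?k * h < real N * h" using t by auto
        then have "?k < N" using h by simp
        then show ?thesis using c by (intro UN_I[of ?k]) (auto simp del: of_nat_Suc)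
      qed
    qed
    show "L-lipschitz_on {real k * h..real (Suc k) * h} (pl_interpolant h X)" if "k \<in> {..<N}" for k
    proof (rule lipschitz_onI)
      fix s t assume st: "s \<in> {real k * h..real (Suc k) * h}" "t \<in> {real k * h..real (Suc k) * h}"
      have "pl_interpolant h X s - pl_interpolant h X t = (s - t) *\<^sub>R ((1 / h) *\<^sub>R (X (Suc k) - X k))"
        using h by (simp add: pl_interpolant_piece[OF h st(1)] pl_interpolant_piece[OF h st(2)]
          scaleR_left_diff_distrib[symmetric] diff_divide_distrib[symmetric] del: of_nat_Suc)
      then have "dist (pl_interpolant h X s) (pl_interpolant h X t) =
          norm ((1 / h) *\<^sub>R (X (Suc k) - X k)) * dist s t"
        by (simp only: dist_norm norm_scaleR real_norm_def mult_ac)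
      also have "\<dots> \<le> L * dist s t"
        unfolding L_def using that by (intro mult_right_mono member_le_sum) auto
      finally show "dist (pl_interpolant h X s) (pl_interpolant h X t) \<le> L * dist s t" .
    qed (auto simp: L_def intro: sum_nonneg)
  qed (auto simp: L_def intro: sum_nonneg)
  then show thesis by (rule that)
qed

lemma pl_interpolant_has_vector_derivative_off_grid:
  fixes X :: "nat \<Rightarrow> 'a::real_normed_vector"
  assumes h: "h > 0" and t: "t > 0" "t \<notin> range (\<lambda>k. real k * h)"
  shows "(pl_interpolant h X has_vector_derivative left_deriv (pl_interpolant h X) t) (at t)"
proof -
  obtain k where k: "real k * h < t" "t \<le> real (Suc k) * h" using grid_cell[OF h t(1)] by blast
  moreover have "t \<noteq> real (Suc k) * h" using t(2) by blast
  ultimately have int: "real k * h < t" "t < real (Suc k) * h" by auto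
  have "t \<in> {real k * h..real (Suc k) * h}" using int by simp
  from pl_interpolant_has_vector_derivative[OF h this]
  show ?thesis unfolding left_deriv_pl_interpolant[OF h k] using at_within_Icc_at[OF int] by simp
qed

lemma left_deriv_pl_interpolant_bounded_measurable:
  fixes X :: "nat \<Rightarrow> 'a::euclidean_space"
  assumes h: "h > 0"
  shows "left_deriv (pl_interpolant h X) \<in> borel_measurable (lebesgue_on {0..real N * h})"
    and "\<exists>M. \<forall>t\<in>{0..real N * h}. norm (left_deriv (pl_interpolant h X) t) \<le> M"
proof -
  let ?D = "left_deriv (pl_interpolant h X)" and ?s = "\<lambda>k. (1 / h) *\<^sub>R (X (Suc k) - X k)"
  have eq: "?D t = (if t = 0 then ?D 0 else ?s (nat \<lceil>t / h\<rceil> - 1))" if "t \<in> {0..real N * h}" for t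
    using that left_deriv_pl_interpolant[OF h grid_cell[OF h, of t]] by auto
  \<comment> \<open>The slope depends on \<open>t\<close> only through the integer \<open>\<lceil>t / h\<rceil>\<close>.\<close>
  have "(\<lambda>t. ?s (nat \<lceil>t / h\<rceil> - 1)) \<in> borel_measurable borel"
    by (rule measurable_compose[where f = "\<lambda>t. \<lceil>t / h\<rceil>" and g = "\<lambda>i. ?s (nat i - 1)"
          and N = "count_space UNIV"]) measurable
  then have "(\<lambda>t. if t = 0 then ?D 0 else ?s (nat \<lceil>t / h\<rceil> - 1)) \<in> borel_measurable lborel"
    by measurable
  then have "(\<lambda>t. if t = 0 then ?D 0 else ?s (nat \<lceil>t / h\<rceil> - 1)) \<in> borel_measurable (lebesgue_on {0..real N * h})"
    by (intro measurable_restrict_space1 measurable_completion)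
  then show "?D \<in> borel_measurable (lebesgue_on {0..real N * h})"
    by (rule measurable_cong[THEN iffD2, rotated]) (use eq in simp)
  show "\<exists>M. \<forall>t\<in>{0..real N * h}. norm (?D t) \<le> M"
  proof (intro exI ballI)
    fix t assume t: "t \<in> {0..real N * h}"
    show "norm (?D t) \<le> norm (?D 0) + (\<Sum>k<N. norm (?s k))"
    proof (cases "t = 0")
      case False
      let ?k = "nat \<lceil>t / h\<rceil> - 1"
      have "t > 0" using False t by simp
      then have "real ?k * h < real N * h" using grid_cell(1)[OF h, of t] t by simp
      then have "?k < N" using h by simp
      then have "norm (?s ?k) \<le> (\<Sum>k<N. norm (?s k))"
        by (intro member_le_sum) auto
      then show ?thesis using eq[OF t] False by (simp add: add_increasing)
    qed (auto intro: sum_nonneg)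
  qed
qed

section \<open>Averaged Jacobians\<close>

lemma bounded_bilinear_matrix_vector_mult:
  "bounded_bilinear (\<lambda>(A :: real^'n^'m) x. A *v x)"
  by (rule bilinear_conv_bounded_bilinear[THEN iffD1])
    (auto simp: bilinear_def intro!: linearI
      simp: matrix_vector_mult_add_rdistrib scaleR_matrix_vector_assoc matrix_vector_right_distrib
        matrix_vector_mult_scaleR)

lemma bounded_linear_Blinfun_matrix: "bounded_linear (\<lambda>A :: real^'n^'m. Blinfun ((*v) A))"
  by (rule linear_conv_bounded_linear[THEN iffD1], rule linearI)
    (auto intro!: blinfun_eqI simp: bounded_linear_Blinfun_apply blinfun.add_left blinfun.scaleR_left
      matrix_vector_mult_add_rdistrib scaleR_matrix_vector_assoc)

text \<open>
  Continuity of one partial derivative together with existence of the other gives joint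
  differentiability. The matrix-valued partial derivative is transported to bounded linear
  functions, where that criterion is stated.
\<close>

lemma has_derivative_matrix_partials:
  fixes F :: "real^'n \<Rightarrow> real^'m \<Rightarrow> real^'k"
  assumes A: "\<And>u v. ((\<lambda>x. F x v) has_derivative (*v) (A u v)) (at u)"
    and B: "\<And>u v. ((\<lambda>x. F u x) has_derivative (*v) (B u v)) (at v)"
    and cont: "continuous_on UNIV (\<lambda>(u, v). B u v)"
  shows "((\<lambda>(u, v). F u v) has_derivative (\<lambda>(a, b). A u v *v a + B u v *v b)) (at (u, v))"
proof -
  have "((\<lambda>(u, v). F u v) has_derivative (\<lambda>(a, b). A u v *v a + Blinfun ((*v) (B u v)) b))
      (at (u, v) within UNIV \<times> UNIV)"
  proof (rule has_derivative_partialsI)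
    have "continuous_on UNIV (\<lambda>(u, v). Blinfun ((*v) (B u v)))"
      using bounded_linear.continuous_on[OF bounded_linear_Blinfun_matrix cont]
      by (simp add: split_def)
    then show "continuous (at (u, v) within UNIV \<times> UNIV) (\<lambda>(u, v). Blinfun ((*v) (B u v)))"
      by (simp add: continuous_on_eq_continuous_at)
  qed (use A B in \<open>auto simp: bounded_linear_Blinfun_apply\<close>)
  then show ?thesis by (simp add: bounded_linear_Blinfun_apply)
qed

text \<open>
  Integrate the derivative of \<open>F\<close> along the segment from \<open>(Y, Z)\<close> to \<open>(y, z)\<close>. This exact identity,
  with no quadratic remainder, is what makes the averaged Jacobians the right coefficients for the
  adjoint equation.
\<close>

lemma mean_value_averaged_jacobians:
  fixes F :: "real^'n \<Rightarrow> real^'m \<Rightarrow> real^'k"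
  assumes A: "\<And>u v. ((\<lambda>x. F x v) has_derivative (*v) (A u v)) (at u)"
    and B: "\<And>u v. ((\<lambda>x. F u x) has_derivative (*v) (B u v)) (at v)"
    and contA: "continuous_on UNIV (\<lambda>(u, v). A u v)"
    and contB: "continuous_on UNIV (\<lambda>(u, v). B u v)"
  shows "F y z - F Y Z =
    integral {0..1} (\<lambda>s. A (s *\<^sub>R y + (1 - s) *\<^sub>R Y) (s *\<^sub>R z + (1 - s) *\<^sub>R Z)) *v (y - Y) +
    integral {0..1} (\<lambda>s. B (s *\<^sub>R y + (1 - s) *\<^sub>R Y) (s *\<^sub>R z + (1 - s) *\<^sub>R Z)) *v (z - Z)"
proof -
  let ?u = "\<lambda>s. s *\<^sub>R y + (1 - s) *\<^sub>R Y" and ?v = "\<lambda>s. s *\<^sub>R z + (1 - s) *\<^sub>R Z"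
  have "((\<lambda>s. A (?u s) (?v s) *v (y - Y) + B (?u s) (?v s) *v (z - Z)) has_integral
      F (?u 1) (?v 1) - F (?u 0) (?v 0)) {0..1}"
  proof (rule fundamental_theorem_of_calculus)
    fix s :: real
    have "((\<lambda>s. (?u s, ?v s)) has_vector_derivative (y - Y, z - Z)) (at s within {0..1})"
      by (auto intro!: derivative_eq_intros has_vector_derivative_Pair simp: algebra_simps)
    from vector_derivative_diff_chain_within[OF this
        has_derivative_at_withinI[OF has_derivative_matrix_partials[OF A B contB]]]
    show "((\<lambda>s. F (?u s) (?v s)) has_vector_derivative
        A (?u s) (?v s) *v (y - Y) + B (?u s) (?v s) *v (z - Z)) (at s within {0..1})"
      by (simp add: o_def)
  qed simp
  moreover have "((\<lambda>s. A (?u s) (?v s) *v (y - Y) + B (?u s) (?v s) *v (z - Z)) has_integral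
      integral {0..1} (\<lambda>s. A (?u s) (?v s)) *v (y - Y) +
      integral {0..1} (\<lambda>s. B (?u s) (?v s)) *v (z - Z)) {0..1}"
  proof (rule has_integral_add)
    have *: "((\<lambda>s. M (?u s) (?v s) *v w) has_integral integral {0..1} (\<lambda>s. M (?u s) (?v s)) *v w) {0..1}"
      if "continuous_on UNIV (\<lambda>(u, v). M u v)" for M :: "real^'n \<Rightarrow> real^'m \<Rightarrow> real^'l^'k" and w
    proof -
      have "continuous_on {0..1} (\<lambda>s. M (?u s) (?v s))"
        using continuous_on_compose2[OF that, of "{0..1}" "\<lambda>s. (?u s, ?v s)"]
        by (force intro!: continuous_intros)
      then have "((\<lambda>s. M (?u s) (?v s)) has_integral integral {0..1} (\<lambda>s. M (?u s) (?v s))) {0..1}"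
        by (intro integrable_integral integrable_continuous_real)
      from has_integral_linear[OF this bounded_bilinear.bounded_linear_left[OF bounded_bilinear_matrix_vector_mult, of w]]
      show ?thesis by (simp add: o_def)
    qed
    show "((\<lambda>s. A (?u s) (?v s) *v (y - Y)) has_integral
        integral {0..1} (\<lambda>s. A (?u s) (?v s)) *v (y - Y)) {0..1}" by (rule *[OF contA])
    show "((\<lambda>s. B (?u s) (?v s) *v (z - Z)) has_integral
        integral {0..1} (\<lambda>s. B (?u s) (?v s)) *v (z - Z)) {0..1}" by (rule *[OF contB])
  qed
  ultimately show ?thesis by (simp add: has_integral_unique)
qed

lemma C1_on_imp_continuous_on: "C1_on S F \<Longrightarrow> continuous_on S F"
  unfolding C1_on_def by (meson continuous_on_eq_continuous_within has_derivative_continuous)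

text \<open>
  Differentiation under the integral sign; it provides the time derivative of the averaged Jacobian
  of the constraint, which enters the terminal value of the adjoint.
\<close>

lemma C1_on_segment_average_has_vector_derivative:
  fixes p q :: "real \<Rightarrow> 'a::real_normed_vector" and J :: "'a \<Rightarrow> real \<Rightarrow> 'b::banach"
  assumes J: "C1_on (UNIV \<times> I) (\<lambda>(u, t). J u t)"
    and I: "{a..b} \<subseteq> I" and x: "x \<in> {a..b}"
    and p: "\<And>t. t \<in> {a..b} \<Longrightarrow> (p has_vector_derivative p' t) (at t within {a..b})" "continuous_on {a..b} p'"
    and q: "\<And>t. t \<in> {a..b} \<Longrightarrow> (q has_vector_derivative q' t) (at t within {a..b})" "continuous_on {a..b} q'"
  shows "\<exists>D. ((\<lambda>t. integral {0..1} (\<lambda>s. J (s *\<^sub>R p t + (1 - s) *\<^sub>R q t) t)) has_vector_derivative D)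
    (at x within {a..b})"
proof -
  let ?F = "\<lambda>(u, t). J u t" and ?w = "\<lambda>t s. (s *\<^sub>R p t + (1 - s) *\<^sub>R q t, t)"
  obtain J' where J'c: "continuous_on (UNIV \<times> I) J'"
    and J': "\<And>w. w \<in> UNIV \<times> I \<Longrightarrow> (?F has_derivative blinfun_apply (J' w)) (at w within UNIV \<times> I)"
    using J unfolding C1_on_def by blast
  have pc: "continuous_on {a..b} p" by (rule continuous_on_vector_derivative[OF p(1)])
  have qc: "continuous_on {a..b} q" by (rule continuous_on_vector_derivative[OF q(1)])
  have wc: "continuous_on ({a..b} \<times> cbox 0 1) (\<lambda>(t, s). ?w t s)"
    unfolding split_def
    by (intro continuous_intros continuous_on_compose2[OF pc] continuous_on_compose2[OF qc]) auto
  let ?fx = "\<lambda>t s. blinfun_apply (J' (?w t s)) (s *\<^sub>R p' t + (1 - s) *\<^sub>R q' t, 1)"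
  have "((\<lambda>t. integral (cbox 0 1) (\<lambda>s. ?F (?w t s))) has_vector_derivative
      integral (cbox 0 1) (?fx x)) (at x within {a..b})"
  proof (rule leibniz_rule_vector_derivative)
    fix t s :: real assume t: "t \<in> {a..b}"
    have "((\<lambda>t. ?w t s) has_vector_derivative (s *\<^sub>R p' t + (1 - s) *\<^sub>R q' t, 1)) (at t within {a..b})"
      by (intro has_vector_derivative_Pair has_vector_derivative_add has_vector_derivative_id
        bounded_linear.has_vector_derivative[OF bounded_linear_scaleR_right] p(1) q(1) t)
    moreover have "(?F has_derivative blinfun_apply (J' (?w t s))) (at (?w t s) within (\<lambda>t. ?w t s) ` {a..b})"
      using t I by (intro has_derivative_subset[OF J']) auto
    ultimately show "((\<lambda>t. ?F (?w t s)) has_vector_derivative ?fx t s) (at t within {a..b})"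
      using vector_derivative_diff_chain_within by (fastforce simp: o_def)
  next
    fix t assume t: "t \<in> {a..b}"
    show "(\<lambda>s. ?F (?w t s)) integrable_on cbox 0 1"
      by (intro integrable_continuous continuous_on_compose2[OF C1_on_imp_continuous_on[OF J], of _ "?w t"]
        continuous_intros) (use t I in auto)
  next
    have "continuous_on ({a..b} \<times> cbox 0 1) (\<lambda>z. J' ((\<lambda>(t, s). ?w t s) z))"
      using I by (intro continuous_on_compose2[OF J'c wc]) auto
    then show "continuous_on ({a..b} \<times> cbox 0 1) (\<lambda>(t, s). ?fx t s)"
      unfolding split_def
      by (intro continuous_intros continuous_on_compose2[OF p(2)] continuous_on_compose2[OF q(2)]) auto
  qed (use x in auto)
  then show ?thesis by (auto simp: split_def)
qed

lemma has_derivative_jacobian: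
  fixes F :: "real^'n \<Rightarrow> real^'m"
  shows "F differentiable (at u) \<Longrightarrow> (F has_derivative (*v) (jacobian F (at u))) (at u)"
  by (rule jacobian_works[THEN iffD1])

lemma dae_smooth_f_error:
  fixes f :: "real^'n \<Rightarrow> real^'m \<Rightarrow> real \<Rightarrow> real^'n"
  assumes "dae_smooth T f g" "t \<in> {0..T}"
  shows "f (y t) (z t) t - f (Y t) (Z t) t =
    fy_bar f y z Y Z t *v (y t - Y t) + fz_bar f y z Y Z t *v (z t - Z t)"
  unfolding fy_bar_def fz_bar_def
proof (rule mean_value_averaged_jacobians)
  have slice: "continuous_on UNIV (\<lambda>(u, v). H u v t)"
    if "continuous_on (UNIV \<times> UNIV \<times> {0..T}) (\<lambda>(u, v, t). H u v t)"
    for H :: "real^'n \<Rightarrow> real^'m \<Rightarrow> real \<Rightarrow> 'k::topological_space"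
    using continuous_on_compose2[OF that, of UNIV "\<lambda>(u, v). (u, v, t)"] assms(2)
    by (force simp: split_def intro!: continuous_intros)
  show "((\<lambda>x. f x v t) has_derivative (*v) (jac_fy f u v t)) (at u)"
    "((\<lambda>x. f u x t) has_derivative (*v) (jac_fz f u v t)) (at v)" for u v
    using assms unfolding dae_smooth_def jac_fy_def jac_fz_def by (blast intro: has_derivative_jacobian)+
  show "continuous_on UNIV (\<lambda>(u, v). jac_fy f u v t)" "continuous_on UNIV (\<lambda>(u, v). jac_fz f u v t)"
    using assms(1) unfolding dae_smooth_def by (blast intro: slice)+
qed

lemma dae_smooth_g_error:
  fixes g :: "real^'n \<Rightarrow> real \<Rightarrow> real^'m"
  assumes "dae_smooth T f g" "t \<in> {0..T}"
  shows "g (y t) t - g (Y t) t = gy_bar g y Y t *v (y t - Y t)"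
proof -
  have C1: "C1_on (UNIV \<times> {0..T}) (\<lambda>(u, t). g u t)" "C1_on (UNIV \<times> {0..T}) (\<lambda>(u, t). jac_gy g u t)"
    using assms(1) by (auto simp: dae_smooth_def)
  have "(\<lambda>x. g x t) differentiable (at u)" for u
  proof -
    obtain G' where "((\<lambda>(u, t). g u t) has_derivative G') (at (u, t) within UNIV \<times> {0..T})"
      using C1(1) assms(2) unfolding C1_on_def by blast
    then have "((\<lambda>(u, t). g u t) has_derivative G') (at (u, t) within (\<lambda>x. (x, t)) ` UNIV)"
      by (rule has_derivative_subset) (use assms(2) in auto)
    moreover have "((\<lambda>x. (x, t)) has_derivative (\<lambda>h. (h, 0))) (at u within UNIV)"
      by (auto intro!: derivative_eq_intros)
    ultimately show ?thesis
      using has_derivative_in_compose[of "\<lambda>x. (x, t)" _ u UNIV "\<lambda>(u, t). g u t" G']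
      by (auto simp: differentiable_def)
  qed
  then have 1: "((\<lambda>x. g x t) has_derivative (*v) (jac_gy g u t)) (at u)" for u
    unfolding jac_gy_def by (rule has_derivative_jacobian)
  \<comment> \<open>The constraint is treated as a function of two variables that is constant in a dummy one.\<close>
  have 2: "continuous_on UNIV (\<lambda>(u, v :: real^1). jac_gy g u t)"
    using continuous_on_compose2[OF C1_on_imp_continuous_on[OF C1(2)], of UNIV "\<lambda>(u, v :: real^1). (u, t)"] assms(2)
    by (force simp: split_def intro!: continuous_intros)
  have 3: "((\<lambda>x. g u t) has_derivative (*v) (0 :: real^1^'m)) (at v)" for u and v :: "real^1"
    by (simp add: matrix_vector_mult_0 [abs_def])
  have 4: "continuous_on UNIV (\<lambda>(u :: real^'n, v :: real^1). 0 :: real^1^'m)"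
    by (simp add: split_def)
  show ?thesis
    using mean_value_averaged_jacobians[OF 1 3 2 4, where y = "y t" and Y = "Y t"] by (simp add: gy_bar_def)
qed

section \<open>Duality between the error equation and the adjoint\<close>

lemma square_integrable_inner_bounded:
  fixes \<phi> r :: "real \<Rightarrow> 'a::euclidean_space"
  assumes \<phi>: "square_integrable_on T \<phi>"
    and r: "r \<in> borel_measurable (lebesgue_on {0..T})" "\<And>t. t \<in> {0..T} \<Longrightarrow> norm (r t) \<le> M"
  shows "integrable (lebesgue_on {0..T}) (\<lambda>t. \<phi> t \<bullet> r t)"
proof (rule Bochner_Integration.integrable_bound)
  have "integrable (lebesgue_on {0..T}) (\<lambda>t. 1 :: real)"
    by (rule continuous_imp_integrable_real) auto
  then show "integrable (lebesgue_on {0..T}) (\<lambda>t. M * (1 + (norm (\<phi> t))\<^sup>2))"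
    using \<phi> by (simp add: square_integrable_on_def)
  show "(\<lambda>t. \<phi> t \<bullet> r t) \<in> borel_measurable (lebesgue_on {0..T})"
    using \<phi> r by (intro borel_measurable_inner) (auto simp: square_integrable_on_def)
  show "AE t in lebesgue_on {0..T}. norm (\<phi> t \<bullet> r t) \<le> norm (M * (1 + (norm (\<phi> t))\<^sup>2))"
  proof (rule AE_I2)
    fix t assume "t \<in> space (lebesgue_on {0..T})"
    then have r': "norm (r t) \<le> M" using r by simp
    then have M: "M \<ge> 0" using norm_ge_zero order_trans by blast
    have "0 \<le> (norm (\<phi> t) - 1)\<^sup>2" by simp
    then have "2 * norm (\<phi> t) \<le> 1 + (norm (\<phi> t))\<^sup>2"
      by (simp add: power2_eq_square algebra_simps)
    then have sq: "norm (\<phi> t) \<le> 1 + (norm (\<phi> t))\<^sup>2"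
      using norm_ge_zero[of "\<phi> t"] by linarith
    have "norm (\<phi> t \<bullet> r t) \<le> norm (\<phi> t) * norm (r t)"
      using Cauchy_Schwarz_ineq2 by simp
    also have "\<dots> \<le> (1 + (norm (\<phi> t))\<^sup>2) * M"
      using sq r' by (intro mult_mono) auto
    finally show "norm (\<phi> t \<bullet> r t) \<le> norm (M * (1 + (norm (\<phi> t))\<^sup>2))"
      using M by (simp add: mult.commute)
  qed
qed

lemma continuous_on_imp_square_integrable_on:
  fixes \<phi> :: "real \<Rightarrow> 'a::euclidean_space"
  assumes "continuous_on {0..T} \<phi>"
  shows "square_integrable_on T \<phi>"
  unfolding square_integrable_on_def
  using assms by (auto intro!: continuous_imp_measurable_on_sets_lebesgue continuous_imp_integrable_real
      continuous_intros)

text \<open>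
  Almost everywhere the derivative of \<open>\<phi>y \<bullet> e\<close> is
  \<open>\<phi>y \<bullet> (A e + B d + r) - (A\<^sup>T \<phi>y + C\<^sup>T \<phi>z) \<bullet> e\<close>. The terms with \<open>A\<close> cancel; the term \<open>(B\<^sup>T \<phi>y) \<bullet> d\<close>
  vanishes by the algebraic adjoint equation, which eliminates the algebraic error \<open>d\<close>; and
  \<open>- \<phi>z \<bullet> C e\<close> equals \<open>\<phi>z \<bullet> \<gamma>\<close> by the linearized constraint. Integration from \<open>0\<close> to \<open>T\<close> yields
  the claim.
\<close>

theorem adjoint_duality:
  fixes A :: "real \<Rightarrow> real^'n^'n" and B :: "real \<Rightarrow> real^'m^'n" and C :: "real \<Rightarrow> real^'n^'m"
  assumes T: "0 < T"
    and adj: "adjoint_solution T A B C \<phi>y \<phi>z"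
    and e: "L-lipschitz_on {0..T} e" and S: "negligible S"
    and e': "\<And>t. t \<in> {0..T} - S \<Longrightarrow>
      (e has_vector_derivative (A t *v e t + B t *v d t + r t)) (at t within {0..T})"
    and constr: "\<And>t. t \<in> {0..T} \<Longrightarrow> C t *v e t = - \<gamma> t"
    and r: "r \<in> borel_measurable (lebesgue_on {0..T})" "\<And>t. t \<in> {0..T} \<Longrightarrow> norm (r t) \<le> M"
    and \<gamma>: "continuous_on {0..T} \<gamma>"
  shows "\<phi>y T \<bullet> e T = \<phi>y 0 \<bullet> e 0 + L2_inner T \<phi>y r + L2_inner T \<phi>z \<gamma>"
proof -
  have ac: "abs_continuous_on {0..T} \<phi>y" and sq: "square_integrable_on T \<phi>z"
    and ae: "AE t in lebesgue_on {0..T}.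
        (\<phi>y has_vector_derivative - (transpose (A t) *v \<phi>y t + transpose (C t) *v \<phi>z t)) (at t) \<and>
        0 = transpose (B t) *v \<phi>y t"
    using adj by (auto simp: adjoint_solution_def)
  then obtain N where N: "negligible N"
    and deriv: "\<And>t. t \<in> {0..T} - N \<Longrightarrow>
        (\<phi>y has_vector_derivative - (transpose (A t) *v \<phi>y t + transpose (C t) *v \<phi>z t)) (at t)"
      "\<And>t. t \<in> {0..T} - N \<Longrightarrow> transpose (B t) *v \<phi>y t = 0"
    by (subst (asm) AE_restrict_space_iff)
      (auto simp: eventually_ae_filter_negligible subset_iff simp del: transpose_matrix_vector)
  have "((\<lambda>t. \<phi>y t \<bullet> r t + \<phi>z t \<bullet> \<gamma> t) has_integral \<phi>y T \<bullet> e T - \<phi>y 0 \<bullet> e 0) {0..T}"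
  proof (rule abs_continuous_on_has_integral_derivative)
    show "negligible (S \<union> N)" using S N by simp
    fix t assume t: "t \<in> {0..T} - (S \<union> N)"
    let ?\<phi>' = "- (transpose (A t) *v \<phi>y t + transpose (C t) *v \<phi>z t)"
    let ?e' = "A t *v e t + B t *v d t + r t"
    have "((\<lambda>t. \<phi>y t \<bullet> e t) has_vector_derivative \<phi>y t \<bullet> ?e' + ?\<phi>' \<bullet> e t) (at t within {0..T})"
      by (rule bounded_bilinear.has_vector_derivative[OF bounded_bilinear_inner])
        (use t deriv e' in \<open>auto intro: has_vector_derivative_at_within\<close>)
    also have "\<phi>y t \<bullet> ?e' + ?\<phi>' \<bullet> e t = \<phi>y t \<bullet> r t + (transpose (B t) *v \<phi>y t) \<bullet> d t - \<phi>z t \<bullet> (C t *v e t)"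
      by (simp add: inner_add inner_diff dot_lmul_matrix)
    also have "\<dots> = \<phi>y t \<bullet> r t + \<phi>z t \<bullet> \<gamma> t"
      using t deriv(2)[of t] constr[of t] by (simp del: transpose_matrix_vector)
    finally show "((\<lambda>t. \<phi>y t \<bullet> e t) has_vector_derivative \<phi>y t \<bullet> r t + \<phi>z t \<bullet> \<gamma> t) (at t within {0..T})" .
  qed (use T ac e in \<open>auto intro: abs_continuous_on_inner_lipschitz\<close>)
  moreover have "((\<lambda>t. \<phi>y t \<bullet> r t + \<phi>z t \<bullet> \<gamma> t) has_integral L2_inner T \<phi>y r + L2_inner T \<phi>z \<gamma>) {0..T}"
    unfolding L2_inner_def
  proof (intro has_integral_add has_integral_integral_lebesgue_on)
    show "integrable (lebesgue_on {0..T}) (\<lambda>t. \<phi>y t \<bullet> r t)"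
      using ac r by (intro square_integrable_inner_bounded continuous_on_imp_square_integrable_on
        abs_continuous_on_imp_continuous_on)
    have "bounded (\<gamma> ` {0..T})" using \<gamma> by (intro compact_imp_bounded compact_continuous_image) auto
    then obtain M' where "\<And>t. t \<in> {0..T} \<Longrightarrow> norm (\<gamma> t) \<le> M'" unfolding bounded_iff by blast
    then show "integrable (lebesgue_on {0..T}) (\<lambda>t. \<phi>z t \<bullet> \<gamma> t)"
      using sq \<gamma> by (intro square_integrable_inner_bounded continuous_imp_measurable_on_sets_lebesgue) auto
  qed auto
  ultimately show ?thesis by (simp add: has_integral_iff)
qed


section \<open>The terminal value of the adjoint\<close>

lemma matrix_mult_matrix_inv:
  assumes "invertible A"
  shows "A ** matrix_inv A = mat 1"
  using assms unfolding invertible_def matrix_inv_def by (metis (mono_tags, lifting) someI_ex)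

lemma inner_transpose_mult: "(transpose A *v x) \<bullet> y = x \<bullet> (A *v y)" for A :: "real^'n^'m"
  by (simp add: dot_lmul_matrix)

text \<open>
  Why the terminal value is the right one. The projection \<open>P\<close> fixes \<open>e\<close>, because \<open>C e = 0\<close>. With
  \<open>w = W \<zeta>z\<close>, the two correction terms subtract \<open>w \<bullet> (C A e + C' e)\<close> from \<open>\<zeta>y \<bullet> e\<close>, and the differentiated
  constraint \<open>deriv\<close> expresses this through \<open>\<gamma>'\<close>, \<open>C r\<close> and \<open>C B d\<close>. Finally
  \<open>w \<bullet> C B d = \<zeta>z \<bullet> d\<close> by the choice of \<open>W\<close>: differentiating the constraint once
  makes the algebraic error visible, as expected for index 2.
\<close>

lemma terminal_adjoint_pairing:
  fixes A :: "real^'n^'n" and B :: "real^'m^'n" and C C' :: "real^'n^'m"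
  assumes inv: "invertible (transpose B ** transpose C)"
    and W: "W = matrix_inv (transpose B ** transpose C)"
    and P: "P = mat 1 - B ** matrix_inv (C ** B) ** C"
    and Ce: "C *v e = 0"
    and deriv: "C' *v e + C *v (A *v e + B *v d + r) = - \<gamma>'"
    and \<phi>: "\<phi> = transpose P *v (\<zeta>y - (transpose A ** transpose C ** W) *v \<zeta>z - (transpose C' ** W) *v \<zeta>z)"
  shows "\<phi> \<bullet> e = e \<bullet> \<zeta>y + d \<bullet> \<zeta>z + ((transpose C ** W) *v \<zeta>z) \<bullet> r + (W *v \<zeta>z) \<bullet> \<gamma>'"
proof -
  define w where "w = W *v \<zeta>z"
  have "P *v e = e"
    unfolding P by (simp add: matrix_vector_mult_diff_rdistrib matrix_vector_mul_assoc[symmetric] Ce)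
  then have "\<phi> \<bullet> e = (\<zeta>y - (transpose A ** transpose C ** W) *v \<zeta>z - (transpose C' ** W) *v \<zeta>z) \<bullet> e"
    unfolding \<phi> inner_transpose_mult by simp
  also have "\<dots> = \<zeta>y \<bullet> e - w \<bullet> (C *v (A *v e)) - w \<bullet> (C' *v e)"
    by (simp add: inner_diff_left matrix_vector_mul_assoc[symmetric] inner_transpose_mult w_def[symmetric]
      del: transpose_matrix_vector)
  also have "\<dots> = \<zeta>y \<bullet> e - w \<bullet> (C' *v e + C *v (A *v e + B *v d + r)) + w \<bullet> (C *v r) + w \<bullet> (C *v (B *v d))"
    by (simp add: matrix_vector_right_distrib inner_add_right)
  also have "w \<bullet> (C *v (B *v d)) = ((transpose B ** transpose C ** W) *v \<zeta>z) \<bullet> d"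
    by (simp add: matrix_vector_mul_assoc[symmetric] inner_transpose_mult w_def[symmetric]
      del: transpose_matrix_vector)
  also have "transpose B ** transpose C ** W = mat 1"
    unfolding W by (rule matrix_mult_matrix_inv[OF inv])
  also have "w \<bullet> (C *v r) = ((transpose C ** W) *v \<zeta>z) \<bullet> r"
    by (simp add: matrix_vector_mul_assoc[symmetric] inner_transpose_mult w_def[symmetric]
      del: transpose_matrix_vector)
  finally show ?thesis by (simp add: deriv w_def inner_commute)
qed

lemma bounded_linear_transpose: "bounded_linear (transpose :: real^'n^'m \<Rightarrow> real^'m^'n)"
  by (rule linear_conv_bounded_linear[THEN iffD1], rule linearI) (simp_all add: transpose_def vec_eq_iff)

section \<open>The error representation\<close>

theorem theorem3p5:
  fixes f :: "real^'n \<Rightarrow> real^'m \<Rightarrow> real \<Rightarrow> real^'n"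
    and g :: "real^'n \<Rightarrow> real \<Rightarrow> real^'m"
    and y Y ey \<phi>y :: "real \<Rightarrow> real^'n"
    and z Z ez \<phi>z :: "real \<Rightarrow> real^'m"
    and Ys :: "nat \<Rightarrow> real^'n" and Zs :: "nat \<Rightarrow> real^'m"
    and T :: real and N :: nat
    and \<zeta>y :: "real^'n" and \<zeta>z :: "real^'m"
    and fy :: "real \<Rightarrow> real^'n^'n" and fz :: "real \<Rightarrow> real^'m^'n"
    and gy :: "real \<Rightarrow> real^'n^'m" and P :: "real \<Rightarrow> real^'n^'n"
    and W :: "real^'m^'m"
  assumes T: "0 < T" and N: "0 < N"
    and smooth: "dae_smooth T f g"
    and sol: "dae_solution T f g y z"
    and index2: "hessenberg_index2 T f g y z"
    and num: "bdf1_values T N f g (y 0) (z 0) Ys Zs"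
    and Y: "Y = pl_interpolant (T / real N) Ys"
    and Z: "Z = pl_interpolant (T / real N) Zs"
    and ey: "ey = (\<lambda>t. y t - Y t)"
    and ez: "ez = (\<lambda>t. z t - Z t)"
    and fy: "fy = fy_bar f y z Y Z"
    and fz: "fz = fz_bar f y z Y Z"
    and gy: "gy = gy_bar g y Y"
    and close: "\<And>t. t \<in> {0..T} \<Longrightarrow> invertible (transpose (fz t) ** transpose (gy t))"
    and P: "P = (\<lambda>t. mat 1 - fz t ** matrix_inv (gy t ** fz t) ** gy t)"
    and W: "W = matrix_inv (transpose (fz T) ** transpose (gy T))"
    and adj: "adjoint_solution T fy fz gy \<phi>y \<phi>z"
    and adj_T: "\<phi>y T = transpose (P T) *v
      (\<zeta>y - (transpose (fy T) ** transpose (gy T) ** W) *v \<zeta>z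
          - (left_deriv (\<lambda>t. transpose (gy t)) T ** W) *v \<zeta>z)"
  shows "qoi T \<zeta>y \<zeta>z y z - qoi T \<zeta>y \<zeta>z Y Z = ey T \<bullet> \<zeta>y + ez T \<bullet> \<zeta>z \<and>
    qoi T \<zeta>y \<zeta>z y z - qoi T \<zeta>y \<zeta>z Y Z =
      \<phi>y 0 \<bullet> ey 0
      + L2_inner T \<phi>y (\<lambda>t. f (Y t) (Z t) t - left_deriv Y t)
      + L2_inner T \<phi>z (\<lambda>t. g (Y t) t)
      - ((transpose (gy T) ** W) *v \<zeta>z) \<bullet> (f (Y T) (Z T) T - left_deriv Y T)
      - (W *v \<zeta>z) \<bullet> left_deriv (\<lambda>t. g (Y t) t) T"
proof -
  define h where "h = T / real N"
  have h: "h > 0" and Nh: "real N * h = T" using T N by (auto simp: h_def)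
  have Yh: "Y = pl_interpolant h Ys" and Zh: "Z = pl_interpolant h Zs" by (simp_all add: Y Z h_def)
  obtain LY LZ where LY: "LY-lipschitz_on {0..T} Y" and LZ: "LZ-lipschitz_on {0..T} Z"
    using pl_interpolant_lipschitz[OF h N] unfolding Yh Zh Nh by metis
  have contY: "continuous_on {0..T} Y" and contZ: "continuous_on {0..T} Z"
    using LY LZ by (auto intro: lipschitz_on_continuous_on)

  let ?fyz = "\<lambda>t. f (y t) (z t) t"
  have y': "(y has_vector_derivative ?fyz t) (at t within {0..T})" and gy0: "g (y t) t = 0"
    if "t \<in> {0..T}" for t using sol that by (auto simp: dae_solution_def)
  have conty: "continuous_on {0..T} y" by (rule continuous_on_vector_derivative[OF y'])
  have contz: "continuous_on {0..T} z" using sol by (simp add: dae_solution_def)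
  have contf: "continuous_on {0..T} (\<lambda>t. f (u t) (v t) t)"
    if "continuous_on {0..T} u" "continuous_on {0..T} v" for u v
  proof -
    have "continuous_on (UNIV \<times> UNIV \<times> {0..T}) (\<lambda>(u, v, t). f u v t)"
      using smooth by (simp add: dae_smooth_def)
    from continuous_on_compose2[OF this, of "{0..T}" "\<lambda>t. (u t, v t, t)"] that show ?thesis
      by (force intro!: continuous_intros)
  qed
  have contfyz: "continuous_on {0..T} ?fyz" by (rule contf[OF conty contz])
  obtain Ly where Ly: "Ly-lipschitz_on {0..T} y"
    using lipschitz_on_continuous_vector_derivative[OF y' contfyz] by blast
  have contg: "continuous_on {0..T} (\<lambda>t. g (Y t) t)"
  proof -
    have "C1_on (UNIV \<times> {0..T}) (\<lambda>(u, t). g u t)" using smooth by (simp add: dae_smooth_def)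
    from continuous_on_compose2[OF C1_on_imp_continuous_on[OF this], of "{0..T}" "\<lambda>t. (Y t, t)"] contY
    show ?thesis by (force intro!: continuous_intros)
  qed

  let ?r = "\<lambda>t. f (Y t) (Z t) t - left_deriv Y t"
  have e'_eq: "?fyz t - left_deriv Y t = fy t *v ey t + fz t *v ez t + ?r t" if "t \<in> {0..T}" for t
    using dae_smooth_f_error[OF smooth that, of y z Y Z] by (simp add: ey ez fy fz algebra_simps)
  have constr: "gy t *v ey t = - g (Y t) t" if "t \<in> {0..T}" for t
    using dae_smooth_g_error[OF smooth that, of y Y] gy0[OF that] by (simp add: ey gy)

  have duality: "\<phi>y T \<bullet> ey T = \<phi>y 0 \<bullet> ey 0 + L2_inner T \<phi>y ?r + L2_inner T \<phi>z (\<lambda>t. g (Y t) t)"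
  proof -
    obtain M1 where M1: "\<And>t. t \<in> {0..T} \<Longrightarrow> norm (left_deriv Y t) \<le> M1"
      using left_deriv_pl_interpolant_bounded_measurable(2)[OF h] unfolding Yh Nh[symmetric] by blast
    have contfYZ: "continuous_on {0..T} (\<lambda>t. f (Y t) (Z t) t)" by (rule contf[OF contY contZ])
    then have "bounded ((\<lambda>t. f (Y t) (Z t) t) ` {0..T})"
      by (intro compact_imp_bounded compact_continuous_image) auto
    then obtain M2 where M2: "\<And>t. t \<in> {0..T} \<Longrightarrow> norm (f (Y t) (Z t) t) \<le> M2"
      unfolding bounded_iff by blast
    show ?thesis
    proof (rule adjoint_duality[OF T adj])
      show "(Ly + LY)-lipschitz_on {0..T} ey" unfolding ey by (rule lipschitz_on_diff[OF Ly LY])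
      show "negligible (range (\<lambda>k. real k * h))"
        by (simp add: negligible_iff_null_sets null_sets_completionI countable_imp_null_set_lborel)
      show "(ey has_vector_derivative fy t *v ey t + fz t *v ez t + ?r t) (at t within {0..T})"
        if t: "t \<in> {0..T} - range (\<lambda>k. real k * h)" for t
      proof -
        have "0 \<in> range (\<lambda>k. real k * h)" by (rule range_eqI[of _ _ 0]) simp
        then have "t \<noteq> 0" using t by auto
        then have "t > 0" using t by auto
        then have "(Y has_vector_derivative left_deriv Y t) (at t)"
          using pl_interpolant_has_vector_derivative_off_grid[OF h, of t Ys] t by (simp add: Yh)
        then have "(Y has_vector_derivative left_deriv Y t) (at t within {0..T})"
          by (rule has_vector_derivative_at_within)
        with y'[of t] t show ?thesis unfolding e'_eq[symmetric, of t, OF DiffD1[OF t]]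
          by (subst ey) (auto intro: has_vector_derivative_diff)
      qed
      show "?r \<in> borel_measurable (lebesgue_on {0..T})"
        using left_deriv_pl_interpolant_bounded_measurable(1)[OF h, of Ys N] contfYZ
        unfolding Yh[symmetric] Nh
        by (intro borel_measurable_diff) (auto intro: continuous_imp_measurable_on_sets_lebesgue)
      show "norm (?r t) \<le> M2 + M1" if "t \<in> {0..T}" for t
        using M1[OF that] M2[OF that] norm_triangle_ineq4[of "f (Y t) (Z t) t" "left_deriv Y t"] by linarith
    qed (use constr contg in auto)
  qed

  \<comment> \<open>On the last cell \<open>Y\<close> is affine, so \<open>ey\<close> and \<open>gy\<close> are differentiable from the left at \<open>T\<close>.\<close>
  obtain K where K: "N = Suc K" using N by (cases N) auto
  define c where "c = real K * h"
  have TK: "T = real (Suc K) * h" using Nh K by simp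
  have c: "0 \<le> c" "c < T" using h by (auto simp: c_def TK algebra_simps)
  let ?I = "{c..T}"
  have sub: "?I \<subseteq> {0..T}" using c by auto
  have Ycell: "(Y has_vector_derivative left_deriv Y T) (at t within ?I)" if "t \<in> ?I" for t
    using pl_interpolant_has_vector_derivative[OF h, of t K Ys] that
      left_deriv_pl_interpolant[OF h, of K T Ys] c unfolding Yh c_def TK by simp
  have ycell: "(y has_vector_derivative ?fyz t) (at t within ?I)" if "t \<in> ?I" for t
    using y' that sub by (meson has_vector_derivative_within_subset subsetD)
  have eT: "(ey has_vector_derivative fy T *v ey T + fz T *v ez T + ?r T) (at T within ?I)"
  proof -
    have "T \<in> {0..T}" using T by simp
    show ?thesis unfolding e'_eq[OF \<open>T \<in> {0..T}\<close>, symmetric]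
      by (subst ey, rule has_vector_derivative_diff) (use Ycell ycell c in auto)
  qed
  have "\<exists>D. (gy has_vector_derivative D) (at T within ?I)"
  proof -
    have "C1_on (UNIV \<times> {0..T}) (\<lambda>(u, t). jac_gy g u t)" using smooth by (simp add: dae_smooth_def)
    from C1_on_segment_average_has_vector_derivative[OF this sub _ ycell _ Ycell, of T] c
    show ?thesis unfolding gy gy_bar_def[abs_def]
      by (simp add: continuous_on_subset[OF contfyz sub])
  qed
  then obtain D where D: "(gy has_vector_derivative D) (at T within ?I)" by blast
  have DT: "left_deriv (\<lambda>t. transpose (gy t)) T = transpose D"
    by (rule left_deriv_eqI[OF bounded_linear.has_vector_derivative[OF bounded_linear_transpose D] c(2)])
  \<comment> \<open>The linearized constraint holds on the whole cell and can be differentiated as a product.\<close>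
  have g': "left_deriv (\<lambda>t. g (Y t) t) T =
      - (gy T *v (fy T *v ey T + fz T *v ez T + ?r T) + D *v ey T)"
  proof (rule left_deriv_eqI[OF has_vector_derivative_transform c(2)])
    show "T \<in> ?I" using c by simp
    show "((\<lambda>t. - (gy t *v ey t)) has_vector_derivative
        - (gy T *v (fy T *v ey T + fz T *v ez T + ?r T) + D *v ey T)) (at T within ?I)"
      by (intro has_vector_derivative_minus
          bounded_bilinear.has_vector_derivative[OF bounded_bilinear_matrix_vector_mult D eT])
    show "g (Y t) t = - (gy t *v ey t)" if "t \<in> ?I" for t using constr sub that by auto
  qed

  \<comment> \<open>The implicit Euler values satisfy the constraint exactly at the grid point \<open>T\<close>.\<close>
  have "g (Y T) T = 0"
  proof -
    have "Y T = Ys N" using pl_interpolant_grid[OF h, of Ys N] by (simp add: Yh Nh)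
    moreover have "g (Ys N) T = 0"
    proof -
      have "K < N" by (simp add: K)
      then have "0 = g (Ys (Suc K)) (real (Suc K) * (T / real N))"
        using num unfolding bdf1_values_def by blast
      then show ?thesis using Nh unfolding K[symmetric] h_def by simp
    qed
    ultimately show ?thesis by simp
  qed
  then have "gy T *v ey T = 0" using constr[of T] T by simp
  moreover have "D *v ey T + gy T *v (fy T *v ey T + fz T *v ez T + ?r T) = - left_deriv (\<lambda>t. g (Y t) t) T"
    unfolding g' by simp
  moreover have "invertible (transpose (fz T) ** transpose (gy T))" using close T by simp
  moreover have "P T = mat 1 - fz T ** matrix_inv (gy T ** fz T) ** gy T" by (simp add: P)
  ultimately have "\<phi>y T \<bullet> ey T = ey T \<bullet> \<zeta>y + ez T \<bullet> \<zeta>z + ((transpose (gy T) ** W) *v \<zeta>z) \<bullet> ?r T +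
      (W *v \<zeta>z) \<bullet> left_deriv (\<lambda>t. g (Y t) t) T"
    using W adj_T[unfolded DT] by (intro terminal_adjoint_pairing)
  moreover have "qoi T \<zeta>y \<zeta>z y z - qoi T \<zeta>y \<zeta>z Y Z = ey T \<bullet> \<zeta>y + ez T \<bullet> \<zeta>z"
    by (simp add: qoi_def ey ez inner_diff_left)
  ultimately show ?thesis using duality by simp
qed

end
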